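(* The following statements are equivalent: (i) the set of prime numbers is infinite; (ii) $\mathrm{VCdim}(\mathcal{H}') = \infty$.
   Context: Let $\mathcal{X} = \{n \in \mathbb{N} : n \geq 2\}$, where $\mathbb{N}$ is the set of positive integers. For $p \in \mathcal{X}$ define $h_p : \mathcal{X} \to \{0,1\}$ by $h_p(x) = 1$ if $x \leq p$ or $p \nmid x$, and $h_p(x) = 0$ otherwise (so $h_p(x) = 0$ if and only if $p \mid x$ and $x > p$). Let $\mathcal{H}' = \{h_p : p \in \mathcal{X},\ p \text{ is prime}\}$. A class $\mathcal{G}$ of functions $g : \mathcal{X} \to \{0,1\}$ shatters a set $C = \{c_1, \dots, c_\ell\} \subset \mathcal{X}$ of $\ell$ distinct elements if $\big|\{(g(c_1), \dots, g(c_\ell)) : g \in \mathcal{G}\}\big| = 2^\ell$. The VC-dimension $\mathrm{VCdim}(\mathcal{G})$ is the size of the largest set that $\mathcal{G}$ shatters, and is $\infty$ if $\mathcal{G}$ shatters sets of arbitrarily large finite size. *)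

theory Defs
  imports
    Main
    "HOL-Library.FuncSet"
    "HOL-Library.Extended_Nat"
    "HOL-Computational_Algebra.Primes"
begin

definition domX :: "nat set" where
  "domX = {n. n \<ge> 2}"

text \<open>Functions from \<open>domX\<close> to \<open>{0,1}\<close> are the elements of \<open>domX \<rightarrow>\<^sub>E {0, 1}\<close>.\<close>

definition h :: "nat \<Rightarrow> nat \<Rightarrow> nat" where
  "h p = (\<lambda>x\<in>domX. if x \<le> p \<or> \<not> p dvd x then 1 else 0)"

definition prime_class :: "(nat \<Rightarrow> nat) set" where
  "prime_class = {h p | p. p \<in> domX \<and> prime p}"

lemma prime_class_subset: "prime_class \<subseteq> domX \<rightarrow>\<^sub>E {0, 1}"
  by (auto simp: prime_class_def h_def)

text \<open>
  The tuple of values of \<open>g\<close> at the distinct elements of \<open>C\<close> is represented as a family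
  indexed by \<open>C\<close> itself, namely \<open>restrict g C\<close>.  The definitions are meant for classes
  \<open>G \<subseteq> domX \<rightarrow>\<^sub>E {0, 1}\<close>.
\<close>

definition shatters :: "(nat \<Rightarrow> nat) set \<Rightarrow> nat set \<Rightarrow> bool" where
  "shatters G C \<longleftrightarrow>
     finite C \<and> C \<subseteq> domX \<and> card ((\<lambda>g. restrict g C) ` G) = 2 ^ card C"

text \<open>
  The supremum in \<open>enat\<close> is the maximum of the sizes if these are bounded, and \<open>\<infinity>\<close> if they
  are not.  For the empty class, which shatters no set at all, it is \<open>0\<close>.
\<close>

definition VCdim :: "(nat \<Rightarrow> nat) set \<Rightarrow> enat" where
  "VCdim G = Sup {enat (card C) | C. shatters G C}"

end

theory Submission imports Defs
begin

text \<open>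
  A class that shatters \<open>C\<close> has at least \<open>2 ^ card C\<close> members, so a finite class has finite
  VC-dimension; and \<open>prime_class\<close> has at most as many members as there are primes.

  Conversely, infinitely many primes make it possible to choose, for any \<open>n\<close>, distinct primes
  \<open>q B\<close> indexed by the subsets \<open>B\<close> of \<open>{..<n}\<close>. Let \<open>c i\<close> be the square of the product of all
  \<open>q B\<close> with \<open>i \<in> B\<close>. By unique factorization \<open>q B\<close> divides \<open>c i\<close> exactly when \<open>i \<in> B\<close>, and
  because of the square it is then smaller than \<open>c i\<close>. So \<open>h (q B)\<close> vanishes on exactly
  those \<open>c i\<close> with \<open>i \<in> B\<close>: every pattern of zeros on \<open>c 0, \<dots>, c (n - 1)\<close> is realized.
  These two directions are the lemmas \<open>VCdim_finite_class\<close> and \<open>prime_class_shatters\<close>.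
\<close>

text \<open>
  For two-valued functions a tuple of values is the set of its zeros. This replaces the count of
  tuples in the definition of shattering by a search for a member of the class with given zeros.
\<close>

lemma shattersI:
  assumes "finite C" and "C \<subseteq> domX" and "G \<subseteq> domX \<rightarrow>\<^sub>E {0, 1}"
    and realized: "\<And>B. B \<subseteq> C \<Longrightarrow> \<exists>g\<in>G. \<forall>x\<in>C. g x = 0 \<longleftrightarrow> x \<in> B"
  shows "shatters G C"
proof -
  have "(\<lambda>g. restrict g C) ` G = C \<rightarrow>\<^sub>E {0, 1}"
  proof (intro equalityI subsetI)
    fix f assume "f \<in> (\<lambda>g. restrict g C) ` G"
    with assms(2,3) show "f \<in> C \<rightarrow>\<^sub>E {0, 1}"
      by (fastforce simp: PiE_iff)
  next
    fix f :: "nat \<Rightarrow> nat" assume f: "f \<in> C \<rightarrow>\<^sub>E {0, 1}"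
    obtain g where g: "g \<in> G" "\<And>x. x \<in> C \<Longrightarrow> g x = 0 \<longleftrightarrow> x \<in> {x \<in> C. f x = 0}"
      using realized[of "{x \<in> C. f x = 0}"] by auto
    have "f x = restrict g C x" for x
    proof (cases "x \<in> C")
      case True
      then have "g x \<in> {0, 1}" "f x \<in> {0, 1}"
        using assms(2,3) f g(1) by (meson PiE_mem subsetD)+
      moreover have "g x = 0 \<longleftrightarrow> f x = 0"
        using g(2)[OF True] True by simp
      ultimately show ?thesis
        using True by auto
    next
      case False
      then show ?thesis
        using PiE_arb[OF f False] by simp
    qed
    then have "f = restrict g C"
      by (rule ext)
    with g(1) show "f \<in> (\<lambda>g. restrict g C) ` G"
      by blast
  qed
  with assms(1,2) show ?thesis
    by (simp add: shatters_def card_PiE numeral_2_eq_2)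
qed

lemma shatters_card_less:
  assumes "finite G" and "shatters G C"
  shows "card C < card G"
proof -
  have "card C < 2 ^ card C"
    by (rule less_exp)
  also have "\<dots> \<le> card G"
    using assms card_image_le[of G "\<lambda>g. restrict g C"] by (simp add: shatters_def)
  finally show ?thesis .
qed

lemma VCdim_finite_class:
  assumes "finite G"
  shows "VCdim G \<noteq> \<infinity>"
proof -
  have "VCdim G \<le> enat (card G)"
    unfolding VCdim_def using shatters_card_less[OF assms]
    by (intro Sup_least) (auto intro: less_imp_le)
  then show ?thesis
    by (intro notI) simp
qed

lemma VCdim_eq_infinity:
  assumes "\<And>n. \<exists>C. shatters G C \<and> card C = n"
  shows "VCdim G = \<infinity>"
proof (rule ccontr)
  assume "VCdim G \<noteq> \<infinity>"
  then obtain m where m: "VCdim G = enat m"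
    by auto
  obtain C where "shatters G C" "card C = Suc m"
    using assms by blast
  then have "enat (Suc m) \<le> VCdim G"
    unfolding VCdim_def by (intro Sup_upper) force
  with m show False
    by simp
qed

lemma h_eq_0_iff: "x \<in> domX \<Longrightarrow> h p x = 0 \<longleftrightarrow> p dvd x \<and> p < x"
  by (auto simp: h_def)

text \<open>
  Unique factorization in the form used here: a product of distinct primes remembers
  which of them were multiplied.
\<close>

lemma prime_dvd_prod_image_iff:
  fixes q :: "'a \<Rightarrow> nat"
  assumes "finite S" and "inj_on q S" and "\<And>B. B \<in> S \<Longrightarrow> prime (q B)"
    and "A \<in> S" and "T \<subseteq> S"
  shows "q A dvd (\<Prod>B\<in>T. q B) \<longleftrightarrow> A \<in> T"
proof
  assume "q A dvd (\<Prod>B\<in>T. q B)"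
  then obtain B where B: "B \<in> T" "q A dvd q B"
    using assms finite_subset[of T S] by (auto simp: prime_dvd_prod_iff)
  then have "q A = q B"
    using assms by (meson primes_dvd_imp_eq subsetD)
  with B(1) assms show "A \<in> T"
    by (metis inj_onD subsetD)
next
  assume "A \<in> T"
  with assms show "q A dvd (\<Prod>B\<in>T. q B)"
    using finite_subset[of T S] by (simp add: dvd_prodI)
qed

text \<open>
  One prime is needed for each of the \<open>2 ^ n\<close> patterns of zeros, so the primes are indexed by the
  patterns, and the points to be shattered are built from them. Squaring deals with the
  condition \<open>x > p\<close> in \<open>h p x = 0\<close>: without it, for \<open>n = 1\<close> the only point would be the
  prime \<open>q {0}\<close> itself, at which \<open>h (q {0})\<close> is \<open>1\<close>.
\<close>

lemma prime_class_shatters: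
  assumes inf: "infinite {p :: nat. prime p}"
  shows "\<exists>C. shatters prime_class C \<and> card C = n"
proof -
  define S where "S = Pow {..<n}"
  have "finite S"
    by (simp add: S_def)
  obtain P :: "nat set" where P: "finite P" "card P = card S" "P \<subseteq> {p. prime p}"
    using infinite_arbitrarily_large[OF inf, of "card S"] by blast
  obtain q where q: "bij_betw q S P"
    using finite_same_card_bij[OF \<open>finite S\<close> P(1)] P(2) by auto
  have inj: "inj_on q S"
    using q by (rule bij_betw_imp_inj_on)
  have prime_q: "prime (q B)" if "B \<in> S" for B
    using bij_betwE[OF q] P(3) that by blast
  define c where "c i = (\<Prod>B\<in>{B \<in> S. i \<in> B}. q B)\<^sup>2" for i
  have c_pos: "c i > 0" for i
    unfolding c_def using prime_q by (auto intro!: prod_pos simp: prime_gt_0_nat)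
  have dvd_prod: "q B dvd (\<Prod>B\<in>{B \<in> S. i \<in> B}. q B) \<longleftrightarrow> i \<in> B" if "B \<in> S" for B i
    by (subst prime_dvd_prod_image_iff[OF \<open>finite S\<close> inj prime_q that]) (use that in auto)
  have dvd_c: "q B dvd c i \<longleftrightarrow> i \<in> B" if "B \<in> S" for B i
    using dvd_prod[OF that] prime_q[OF that]
    by (simp add: c_def prime_dvd_power_iff)
  have less_c: "q B < c i" if "B \<in> S" "i \<in> B" for B i
  proof -
    have "(q B)\<^sup>2 dvd c i"
      using dvd_prod that by (simp add: c_def)
    then have "(q B)\<^sup>2 \<le> c i"
      using c_pos by (rule dvd_imp_le)
    moreover have "q B < (q B)\<^sup>2"
      using prime_gt_1_nat[OF prime_q[OF that(1)]] by (simp add: power2_eq_square)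
    ultimately show ?thesis
      by simp
  qed
  have inj_c: "inj_on c {..<n}"
  proof (rule inj_onI)
    fix i j assume "i \<in> {..<n}" and eq: "c i = c j"
    then have "{i} \<in> S"
      by (simp add: S_def)
    then have "q {i} dvd c i"
      by (simp add: dvd_c)
    with \<open>{i} \<in> S\<close> show "i = j"
      unfolding eq by (simp add: dvd_c)
  qed
  have c_domX: "c i \<in> domX" if "i < n" for i
    using less_c[of "{i}" i] prime_gt_1_nat[OF prime_q[of "{i}"]] that
    by (simp add: S_def domX_def)
  have "shatters prime_class (c ` {..<n})"
  proof (rule shattersI)
    fix A assume "A \<subseteq> c ` {..<n}"
    define B where "B = {i. i < n \<and> c i \<in> A}"
    have B: "B \<in> S"
      by (auto simp: B_def S_def)
    have "h (q B) \<in> prime_class"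
      using prime_q[OF B] by (auto simp: prime_class_def domX_def prime_ge_2_nat)
    moreover have "h (q B) (c i) = 0 \<longleftrightarrow> c i \<in> A" if "i < n" for i
      using that B less_c[of B i] dvd_c[of B i] h_eq_0_iff[OF c_domX] by (auto simp: B_def)
    ultimately show "\<exists>g\<in>prime_class. \<forall>x\<in>c ` {..<n}. g x = 0 \<longleftrightarrow> x \<in> A"
      by auto
  qed (use c_domX prime_class_subset in auto)
  moreover have "card (c ` {..<n}) = n"
    by (simp add: card_image inj_c)
  ultimately show ?thesis
    by blast
qed

theorem theorem1p1:
  "infinite {p :: nat. prime p} \<longleftrightarrow> VCdim prime_class = \<infinity>"
proof
  assume "infinite {p :: nat. prime p}"
  then show "VCdim prime_class = \<infinity>"
    by (intro VCdim_eq_infinity prime_class_shatters)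
next
  assume "VCdim prime_class = \<infinity>"
  then have "infinite prime_class"
    using VCdim_finite_class by blast
  moreover have "prime_class \<subseteq> h ` {p. prime p}"
    by (auto simp: prime_class_def)
  ultimately show "infinite {p :: nat. prime p}"
    by (meson finite_surj)
qed

end
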